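(* Let $q, a, b, c$ be complex numbers with $0<|q|<1$ and $|aq/bc|<1$, such that no denominator occurring below vanishes. Then \begin{align*} {}_{2}\psi_{2}\left[\begin{array}{cc} b,&c\\ aq/b,&aq/c \end{array};q,-\frac{aq}{bc}\right] ={}&\frac{(-b,\,aq/bc,\,-q/b,\,b/a,\,q;q)_\infty\,(aq^2/c^2;q^2)_\infty}{(aq/c,\,-1,\,q/c,\,q/b,\,-aq/bc;q)_\infty\,(b^2/a;q^2)_\infty}\\ &+\frac{(aq/bc,\,b,\,-aq/b,\,-b/a,\,q;q)_\infty\,(aq^2/c^2;q^2)_\infty}{(aq/b,\,aq/c,\,-1,\,-aq/bc,\,q/c;q)_\infty\,(b^2/a;q^2)_\infty}. \end{align*}
   Context: For $|p|<1$, $(x;p)_\infty=\prod_{k=0}^{\infty}(1-xp^k)$ and $(x;p)_n=(x;p)_\infty/(xp^n;p)_\infty$ for every integer $n$ (so $(x;p)_{-k}=1/(xp^{-k};p)_k$ for nonnegative integers $k$); here $p=q$ or $p=q^2$. For $n$ an integer or $\infty$, $(x_1,\ldots,x_m;p)_n=(x_1;p)_n\cdots(x_m;p)_n$. An expression like $aq/bc$ means $aq/(bc)$. The bilateral series is ${}_{2}\psi_2\left[\begin{array}{cc} x,&y\\ u,&w\end{array};q,t\right]=\sum_{k=-\infty}^{\infty}\frac{(x,y;q)_k}{(u,w;q)_k}t^k$. As usual, parameters are assumed to be such that all quantities and all terms of the series are well defined (no zero denominators). *)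

theory Defs
  imports "HOL-Analysis.Analysis"
begin

definition qpoch_inf :: "complex \<Rightarrow> complex \<Rightarrow> complex" where
  "qpoch_inf x p = (\<Prod>k. 1 - x * p ^ k)"

text \<open>
  The product form of \<open>(x;p)\<^sub>n\<close> for an integer \<open>n\<close>. It agrees with the quotient
  \<open>(x;p)\<^sub>\<infinity> / (x p\<^sup>n;p)\<^sub>\<infinity>\<close> whenever the latter has nonzero denominator (lemma
  \<open>qpoch_eq_quotient\<close>), and it is also correct where the quotient reads 0/0, that is,
  for \<open>x = p\<^sup>-\<^sup>j\<close> and \<open>0 \<le> n \<le> j\<close>.
\<close>
definition qpoch :: "complex \<Rightarrow> complex \<Rightarrow> int \<Rightarrow> complex" where
  "qpoch x p n =
     (if n \<ge> 0 then \<Prod>k<nat n. 1 - x * p ^ k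
      else 1 / (\<Prod>k<nat (- n). 1 - (x * p powi n) * p ^ k))"

definition qpochs_inf :: "complex list \<Rightarrow> complex \<Rightarrow> complex" where
  "qpochs_inf xs p = (\<Prod>x\<leftarrow>xs. qpoch_inf x p)"

definition qpochs :: "complex list \<Rightarrow> complex \<Rightarrow> int \<Rightarrow> complex" where
  "qpochs xs p n = (\<Prod>x\<leftarrow>xs. qpoch x p n)"

text \<open>
  If \<open>u = q\<^sup>m\<close> with \<open>m \<ge> 1\<close>, then \<open>(u;q)\<^sub>-\<^sub>k\<close> has a pole for \<open>k \<ge> m\<close>, and \<open>1 / (u;q)\<^sub>-\<^sub>k\<close>
  is by convention 0, as usual for series that terminate on the left. Since \<open>1 / 0 = 0\<close>,
  the term below has this value 0 as well.
\<close>
definition psi22_term ::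
  "complex \<Rightarrow> complex \<Rightarrow> complex \<Rightarrow> complex \<Rightarrow> complex \<Rightarrow> complex \<Rightarrow> int \<Rightarrow> complex" where
  "psi22_term x y u w q t k = qpochs [x, y] q k / qpochs [u, w] q k * t powi k"

definition psi22 ::
  "complex \<Rightarrow> complex \<Rightarrow> complex \<Rightarrow> complex \<Rightarrow> complex \<Rightarrow> complex \<Rightarrow> complex" where
  "psi22 x y u w q t = (\<Sum>\<^sub>\<infinity>k\<in>UNIV. psi22_term x y u w q t k)"

lemma convergent_qpoch_inf:
  assumes "norm p < 1"
  shows "convergent_prod (\<lambda>k. 1 - x * p ^ k :: complex)"
proof -
  have "summable (\<lambda>k. norm (x * p ^ k))"
    using assms by (simp add: norm_mult norm_power summable_geometric summable_mult)
  hence "summable (\<lambda>k. norm ((1 - x * p ^ k) - 1))"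
    by simp
  thus ?thesis
    by (intro abs_convergent_prod_imp_convergent_prod summable_imp_abs_convergent_prod)
qed

lemma qpoch_inf_split:
  assumes "norm p < 1"
  shows "qpoch_inf x p = qpoch_inf (x * p ^ n) p * (\<Prod>k<n. 1 - x * p ^ k)"
proof (induction n)
  case (Suc n)
  define y where "y = x * p ^ n"
  have "qpoch_inf y p = (1 - y) * qpoch_inf (y * p) p"
  proof -
    have L: "(\<lambda>n. \<Prod>k\<le>n. 1 - (y * p) * p ^ k) \<longlonglongrightarrow> qpoch_inf (y * p) p"
      by (simp add: qpoch_inf_def convergent_prod_LIMSEQ convergent_qpoch_inf [OF assms])
    have "(\<lambda>n. \<Prod>k\<le>n. 1 - y * p ^ k) \<longlonglongrightarrow> qpoch_inf y p"
      by (simp add: qpoch_inf_def convergent_prod_LIMSEQ convergent_qpoch_inf [OF assms])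
    hence "(\<lambda>n. \<Prod>k\<le>Suc n. 1 - y * p ^ k) \<longlonglongrightarrow> qpoch_inf y p"
      by (rule LIMSEQ_Suc)
    moreover have "(\<Prod>k\<le>Suc n. 1 - y * p ^ k) = (1 - y) * (\<Prod>k\<le>n. 1 - (y * p) * p ^ k)" for n
      by (simp only: prod.atMost_Suc_shift) (simp add: mult_ac)
    ultimately have "(\<lambda>n. (1 - y) * (\<Prod>k\<le>n. 1 - (y * p) * p ^ k)) \<longlonglongrightarrow> qpoch_inf y p"
      by simp
    moreover have "(\<lambda>n. (1 - y) * (\<Prod>k\<le>n. 1 - (y * p) * p ^ k)) \<longlonglongrightarrow> (1 - y) * qpoch_inf (y * p) p"
      by (rule tendsto_mult_left [OF L])
    ultimately show ?thesis
      using LIMSEQ_unique by blast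
  qed
  with Suc show ?case
    by (simp add: y_def mult_ac)
qed simp

lemma qpoch_eq_quotient:
  assumes "0 < norm p" "norm p < 1" and nz: "qpoch_inf (x * p powi n) p \<noteq> 0"
  shows "qpoch x p n = qpoch_inf x p / qpoch_inf (x * p powi n) p"
proof (cases "n \<ge> 0")
  case True
  then show ?thesis
    using nz qpoch_inf_split [OF assms(2), of x "nat n"]
    by (simp add: qpoch_def power_int_def)
next
  case False
  have "x * p powi n * p ^ nat (- n) = x"
    using False assms(1) by (auto simp: power_int_def field_simps)
  with qpoch_inf_split [OF assms(2), of "x * p powi n" "nat (- n)"]
  have eq: "qpoch_inf (x * p powi n) p
      = qpoch_inf x p * (\<Prod>k<nat (- n). 1 - x * p powi n * p ^ k)"
    by simp
  with nz show ?thesis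
    using False by (auto simp: qpoch_def)
qed

end

theory Submission
  imports Defs
begin

text \<open>
  The series is well-poised, and Bailey's summation evaluates it as a single product
  \[ {}_2\psi_2 = \frac{(aq/bc;q)_\infty (aq^2/b^2, aq^2/c^2, q^2, aq, q/a; q^2)_\infty}
       {(aq/b, aq/c, q/b, q/c, -aq/bc; q)_\infty}. \]
  The two-term form follows, because with \<open>\<theta>(x) = (x, q/x; q)\<^sub>\<infinity>\<close> the numerators over the common
  denominator combine by
  \[ (q;q)_\infty^2 \bigl(\theta(-b)\theta(b/a) + \theta(b)\theta(-b/a)\bigr)
     = 2 (q^2;q^2)_\infty^2 (b^2/a, aq^2/b^2, aq, q/a; q^2)_\infty , \]
  which is lemma \<open>theta_products_addition\<close>.

  Bailey's sum is a consequence of a first-order recurrence. Write \<open>\<beta> = 1/b\<close> and \<open>\<gamma> = 1/c\<close>. The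
  terms of the series at \<open>\<gamma>\<close> and at \<open>\<gamma> q\<close> satisfy a telescoping relation
  (\<open>wp_half_contiguous\<close>), which makes the bilateral sums at \<open>\<gamma>\<close> and \<open>\<gamma> q\<close> proportional
  (\<open>wp_bilateral_contiguous\<close>). Iterating it drives \<open>\<gamma>\<close>, and by symmetry \<open>\<beta>\<close>, to \<open>0\<close>; the
  factors accumulate to the infinite products, and the series that remains is
  \<open>\<Sum>\<^sub>k (-a)\<^sup>k q^(k\<^sup>2)\<close> (\<open>wp_bilateral_eq\<close>).

  That theta series is found by applying the same formula at parameters for which the bilateral
  series has only one nonzero term; this gives Jacobi's triple product. With it the identity for
  \<open>\<theta>\<close> becomes an identity between double theta series, proved by splitting a lattice sum according
  to parity (\<open>theta_addition\<close>).
\<close>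

section \<open>Infinite q-shifted factorials\<close>

lemma qpoch_inf_LIMSEQ:
  assumes "norm p < 1"
  shows "(\<lambda>n. \<Prod>k<n. 1 - x * p ^ k) \<longlonglongrightarrow> qpoch_inf x p"
  using convergent_prod_LIMSEQ [OF convergent_qpoch_inf [OF assms, of x]]
  by (simp add: qpoch_inf_def LIMSEQ_lessThan_iff_atMost)

lemma qpoch_inf_eq_0_iff:
  assumes "norm p < 1"
  shows "qpoch_inf x p = 0 \<longleftrightarrow> (\<exists>k. x * p ^ k = 1)"
proof
  assume "qpoch_inf x p = 0"
  then show "\<exists>k. x * p ^ k = 1"
    using prodinf_nonzero [OF convergent_qpoch_inf [OF assms, of x]]
    by (auto simp: qpoch_inf_def)
next
  assume "\<exists>k. x * p ^ k = 1"
  then obtain k where "x * p ^ k = 1" ..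
  then have "(\<Prod>j<Suc k. 1 - x * p ^ j) = 0"
    by simp
  then show "qpoch_inf x p = 0"
    using qpoch_inf_split [OF assms, of x "Suc k"] by simp
qed

lemma qpoch_inf_eq_mult:
  assumes "norm p < 1"
  shows "qpoch_inf x p = (1 - x) * qpoch_inf (x * p) p"
  using qpoch_inf_split [OF assms, of x 1] by simp

lemma qpoch_inf_0 [simp]: "qpoch_inf 0 p = 1"
  by (simp add: qpoch_inf_def)

lemma qpoch_inf_self_nonzero:
  assumes "norm q < 1"
  shows "qpoch_inf q q \<noteq> 0"
proof -
  have "norm (q * q ^ k) < 1" for k
    using assms power_Suc_less_one [of "norm q" k] by (cases "q = 0") (simp_all add: norm_mult norm_power)
  then have "q * q ^ k \<noteq> 1" for k
    by (metis norm_one order_less_irrefl)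
  then show ?thesis
    using assms by (simp add: qpoch_inf_eq_0_iff)
qed

lemma qpoch_inf_bisect:
  assumes "norm q < 1"
  shows "qpoch_inf x q = qpoch_inf x (q^2) * qpoch_inf (x * q) (q^2)"
proof -
  have q2: "norm (q^2) < 1"
    using assms by (simp add: norm_power power_less_one_iff)
  have eq: "(\<Prod>k<2*n. 1 - x * q ^ k)
      = (\<Prod>k<n. 1 - x * (q^2) ^ k) * (\<Prod>k<n. 1 - (x * q) * (q^2) ^ k)" for n
    by (induction n) (simp_all add: power_mult [symmetric] mult_ac)
  have "(\<lambda>n. \<Prod>k<2*n. 1 - x * q ^ k) \<longlonglongrightarrow> qpoch_inf x q"
    using LIMSEQ_subseq_LIMSEQ [OF qpoch_inf_LIMSEQ [OF assms, of x], of "\<lambda>n. 2 * n"]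
    by (simp add: strict_mono_def o_def)
  moreover have "(\<lambda>n. \<Prod>k<2*n. 1 - x * q ^ k) \<longlonglongrightarrow> qpoch_inf x (q^2) * qpoch_inf (x * q) (q^2)"
    unfolding eq by (intro tendsto_mult qpoch_inf_LIMSEQ q2)
  ultimately show ?thesis
    using LIMSEQ_unique by blast
qed

lemma qpoch_inf_mult_uminus:
  assumes "norm q < 1"
  shows "qpoch_inf x q * qpoch_inf (- x) q = qpoch_inf (x^2) (q^2)"
proof -
  have "(1 - x * q ^ k) * (1 - (- x) * q ^ k) = 1 - x^2 * (q^2) ^ k" for k
    by (simp add: algebra_simps power2_eq_square power_mult_distrib)
  then show ?thesis
    using prodinf_mult [OF convergent_qpoch_inf [OF assms, of x] convergent_qpoch_inf [OF assms, of "- x"]]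
    by (simp add: qpoch_inf_def)
qed

section \<open>Half of a well-poised bilateral series\<close>

text \<open>
  Factoring \<open>r\<close> out of each factor leaves \<open>1 + \<bar>q\<bar>\<^sup>j / r\<close>, whose infinite product
  converges. The constant does not depend on \<open>\<beta>\<close>, which is what a dominated limit in
  \<open>\<beta>\<close> requires.
\<close>
lemma prod_diff_powers_bound:
  fixes q :: complex
  assumes "norm q < 1" and "0 < r"
  obtains C where "\<And>\<beta> n. norm \<beta> \<le> r \<Longrightarrow> norm (\<Prod>j<n. \<beta> - q ^ j) \<le> C * r ^ n"
proof
  fix \<beta> :: complex and n :: nat
  assume \<beta>: "norm \<beta> \<le> r"
  have geo: "(\<Sum>j<n. norm q ^ j) \<le> 1 / (1 - norm q)"
  proof -
    have "(\<Sum>j<n. norm q ^ j) \<le> (\<Sum>j. norm q ^ j)"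
      using assms by (intro sum_le_suminf summable_geometric) auto
    then show ?thesis
      using assms by (simp add: suminf_geometric)
  qed
  have "norm (\<Prod>j<n. \<beta> - q ^ j) = (\<Prod>j<n. norm (\<beta> - q ^ j))"
    by (simp add: prod_norm)
  also have "\<dots> \<le> (\<Prod>j<n. r * exp (norm q ^ j / r))"
  proof (intro prod_mono conjI)
    fix j
    have "norm (\<beta> - q ^ j) \<le> r + norm q ^ j"
      using norm_triangle_ineq4 [of \<beta> "q ^ j"] \<beta> by (simp add: norm_power)
    also have "\<dots> = r * (1 + norm q ^ j / r)"
      using assms by (simp add: field_simps)
    also have "\<dots> \<le> r * exp (norm q ^ j / r)"
      using assms by (intro mult_left_mono exp_ge_add_one_self) auto
    finally show "norm (\<beta> - q ^ j) \<le> r * exp (norm q ^ j / r)" .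
  qed auto
  also have "\<dots> = exp ((\<Sum>j<n. norm q ^ j) / r) * r ^ n"
    by (simp add: prod.distrib exp_sum sum_divide_distrib)
  also have "\<dots> \<le> exp (1 / (1 - norm q) / r) * r ^ n"
    using assms(2) divide_right_mono [OF geo, of r]
    by (intro mult_right_mono) simp_all
  finally show "norm (\<Prod>j<n. \<beta> - q ^ j) \<le> exp (1 / (1 - norm q) / r) * r ^ n" .
qed

text \<open>
  The products are quotients of partial products of \<open>(x;q)\<^sub>\<infinity>\<close>. These are bounded, and so
  are their inverses because the limit is nonzero.
\<close>
lemma prod_shifted_lower_bound:
  assumes "norm q < 1" and "qpoch_inf x q \<noteq> 0"
  obtains d where "d > 0" and "\<And>m n. d \<le> norm (\<Prod>j<n. 1 - x * q ^ (m + j))"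
proof -
  define P where "P n = (\<Prod>j<n. 1 - x * q ^ j)" for n
  have lim: "P \<longlonglongrightarrow> qpoch_inf x q"
    unfolding P_def by (rule qpoch_inf_LIMSEQ [OF assms(1)])
  have nz: "P n \<noteq> 0" for n
    using assms qpoch_inf_split [of q x n] by (auto simp: P_def)
  obtain K where K: "K > 0" "\<And>n. norm (P n) \<le> K"
    using convergent_imp_Bseq [OF convergentI [OF lim]] by (auto simp: Bseq_def)
  have "(\<lambda>n. inverse (P n)) \<longlonglongrightarrow> inverse (qpoch_inf x q)"
    by (intro tendsto_inverse lim assms)
  from convergent_imp_Bseq [OF convergentI [OF this]]
  obtain L where L: "L > 0" "\<And>n. norm (inverse (P n)) \<le> L"
    by (auto simp: Bseq_def)
  show thesis
  proof
    show "1 / (K * L) > 0"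
      using K L by simp
    fix m n
    have "P (m + n) = P m * (\<Prod>j<n. 1 - x * q ^ (m + j))"
      by (induction n) (simp_all add: P_def)
    then have "(\<Prod>j<n. 1 - x * q ^ (m + j)) * (P m * inverse (P (m + n))) = 1"
      using nz [of m] nz [of "m + n"] by (simp add: field_simps)
    then have "1 = norm (\<Prod>j<n. 1 - x * q ^ (m + j)) * (norm (P m) * norm (inverse (P (m + n))))"
      by (metis norm_mult norm_one)
    also have "\<dots> \<le> norm (\<Prod>j<n. 1 - x * q ^ (m + j)) * (K * L)"
      using K L by (intro mult_left_mono mult_mono) auto
    finally show "1 / (K * L) \<le> norm (\<Prod>j<n. 1 - x * q ^ (m + j))"
      using K L by (simp add: field_simps)
  qed
qed

text \<open>
  With \<open>\<beta> = 1/b\<close> and \<open>\<gamma> = 1/c\<close> this is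
  \<open>(b,c;q)\<^sub>n / (aq/b,aq/c;q)\<^sub>n (-aq/bc)\<^sup>n\<close>. The reciprocal parameters make the limits
  \<open>b \<rightarrow> \<infinity>\<close> and \<open>c \<rightarrow> \<infinity>\<close> ordinary values at \<open>\<beta> = 0\<close> and \<open>\<gamma> = 0\<close>.
\<close>
definition wp_term :: "complex \<Rightarrow> complex \<Rightarrow> complex \<Rightarrow> complex \<Rightarrow> nat \<Rightarrow> complex" where
  "wp_term q a \<beta> \<gamma> n = (\<Prod>j<n. - (a * q) * (\<beta> - q ^ j) * (\<gamma> - q ^ j)
     / ((1 - a * \<beta> * q * q ^ j) * (1 - a * \<gamma> * q * q ^ j)))"

definition wp_half :: "complex \<Rightarrow> complex \<Rightarrow> complex \<Rightarrow> complex \<Rightarrow> complex" where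
  "wp_half q a \<beta> \<gamma> = (\<Sum>n. wp_term q a \<beta> \<gamma> n)"

lemma wp_term_0 [simp]: "wp_term q a \<beta> \<gamma> 0 = 1"
  by (simp add: wp_term_def)

lemma wp_term_commute: "wp_term q a \<beta> \<gamma> = wp_term q a \<gamma> \<beta>"
  by (simp add: wp_term_def fun_eq_iff mult_ac)

lemma wp_half_commute: "wp_half q a \<beta> \<gamma> = wp_half q a \<gamma> \<beta>"
  by (simp add: wp_half_def wp_term_commute)

text \<open>
  A geometric majorant that is uniform along the orbit \<open>\<gamma> q\<^sup>m\<close>. The radii \<open>r\<close> and \<open>R\<close> are
  free, rather than equal to \<open>\<bar>\<beta>\<bar>\<close> and \<open>\<bar>\<gamma>\<bar>\<close>, so that zero parameters are covered.
\<close>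
lemma wp_term_bound:
  assumes q: "norm q < 1" and r: "0 < r" "norm \<beta> \<le> r" and R: "0 < R" "norm \<gamma> \<le> R"
    and nz: "qpoch_inf (a * \<beta> * q) q \<noteq> 0" "qpoch_inf (a * \<gamma> * q) q \<noteq> 0"
  obtains C where "\<And>m n. norm (wp_term q a \<beta> (\<gamma> * q ^ m) n) \<le> C * (norm (a * q) * r * R) ^ n"
proof -
  obtain C where C: "\<And>z n. norm z \<le> r \<Longrightarrow> norm (\<Prod>j<n. z - q ^ j) \<le> C * r ^ n"
    using prod_diff_powers_bound [OF q r(1)] by blast
  obtain D where D: "\<And>z n. norm z \<le> R \<Longrightarrow> norm (\<Prod>j<n. z - q ^ j) \<le> D * R ^ n"
    using prod_diff_powers_bound [OF q R(1)] by blast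
  obtain d where d: "d > 0" "\<And>m n. d \<le> norm (\<Prod>j<n. 1 - a * \<beta> * q * q ^ (m + j))"
    using prod_shifted_lower_bound [OF q nz(1)] by blast
  obtain e where e: "e > 0" "\<And>m n. e \<le> norm (\<Prod>j<n. 1 - a * \<gamma> * q * q ^ (m + j))"
    using prod_shifted_lower_bound [OF q nz(2)] by blast
  have C0: "C \<ge> 0" and D0: "D \<ge> 0"
    using C [of 0 0] D [of 0 0] r R by simp_all
  show thesis
  proof
    fix m n
    have g: "norm (\<gamma> * q ^ m) \<le> R"
    proof -
      have "norm \<gamma> * norm q ^ m \<le> R * 1"
        using q R by (intro mult_mono power_le_one) auto
      then show ?thesis
        by (simp add: norm_mult norm_power)
    qed
    have "wp_term q a \<beta> (\<gamma> * q ^ m) n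
        = (- (a * q)) ^ n * (\<Prod>j<n. \<beta> - q ^ j) * (\<Prod>j<n. \<gamma> * q ^ m - q ^ j)
          / ((\<Prod>j<n. 1 - a * \<beta> * q * q ^ (0 + j)) * (\<Prod>j<n. 1 - a * \<gamma> * q * q ^ (m + j)))"
      unfolding wp_term_def prod_dividef prod.distrib by (simp add: power_add mult_ac)
    then have "norm (wp_term q a \<beta> (\<gamma> * q ^ m) n)
        = norm (a * q) ^ n * norm (\<Prod>j<n. \<beta> - q ^ j) * norm (\<Prod>j<n. \<gamma> * q ^ m - q ^ j)
          / (norm (\<Prod>j<n. 1 - a * \<beta> * q * q ^ (0 + j)) * norm (\<Prod>j<n. 1 - a * \<gamma> * q * q ^ (m + j)))"
      by (simp only: norm_divide norm_mult norm_power norm_minus_cancel)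
    also have "\<dots> \<le> norm (a * q) ^ n * (C * r ^ n) * (D * R ^ n) / (d * e)"
      using C0 D0 C [OF r(2)] D [OF g] d(1) d(2) [of 0 n] e r R
      by (intro frac_le mult_mono mult_pos_pos mult_nonneg_nonneg) (auto intro: less_imp_le)
    also have "\<dots> = C * D / (d * e) * (norm (a * q) * r * R) ^ n"
      by (simp add: power_mult_distrib)
    finally show "norm (wp_term q a \<beta> (\<gamma> * q ^ m) n) \<le> C * D / (d * e) * (norm (a * q) * r * R) ^ n" .
  qed
qed

lemma wp_radii:
  fixes a q \<beta> \<gamma> :: complex
  assumes "norm (a * q * \<beta> * \<gamma>) < 1"
  obtains r R where "0 < r" "norm \<beta> \<le> r" "0 < R" "norm \<gamma> \<le> R" "norm (a * q) * r * R < 1"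
proof -
  have "((\<lambda>e. norm (a * q) * (norm \<beta> + e) * (norm \<gamma> + e)) \<longlongrightarrow> norm (a * q) * (norm \<beta> + 0) * (norm \<gamma> + 0))
      (at_right (0::real))"
    by (intro tendsto_intros)
  moreover have "norm (a * q) * (norm \<beta> + 0) * (norm \<gamma> + 0) < 1"
    using assms by (simp add: norm_mult)
  ultimately have "\<forall>\<^sub>F e in at_right 0. norm (a * q) * (norm \<beta> + e) * (norm \<gamma> + e) < 1"
    by (rule order_tendstoD)
  moreover have "\<forall>\<^sub>F e in at_right 0. e > (0::real)"
    by (simp add: eventually_at_right_less)
  ultimately have "\<forall>\<^sub>F e in at_right 0. e > 0 \<and> norm (a * q) * (norm \<beta> + e) * (norm \<gamma> + e) < 1"
    by eventually_elim simp
  then obtain e where "e > 0" "norm (a * q) * (norm \<beta> + e) * (norm \<gamma> + e) < 1"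
    using eventually_happens' [OF trivial_limit_at_right_real] by blast
  then show thesis
    by (intro that [of "norm \<beta> + e" "norm \<gamma> + e"]) (auto intro: add_nonneg_pos)
qed

lemma summable_norm_wp_term:
  assumes "norm q < 1" and "norm (a * q * \<beta> * \<gamma>) < 1"
    and "qpoch_inf (a * \<beta> * q) q \<noteq> 0" "qpoch_inf (a * \<gamma> * q) q \<noteq> 0"
  shows "summable (\<lambda>n. norm (wp_term q a \<beta> \<gamma> n))"
proof -
  obtain r R where rR: "0 < r" "norm \<beta> \<le> r" "0 < R" "norm \<gamma> \<le> R" "norm (a * q) * r * R < 1"
    using wp_radii [OF assms(2)] by blast
  obtain C where C: "\<And>m n. norm (wp_term q a \<beta> (\<gamma> * q ^ m) n) \<le> C * (norm (a * q) * r * R) ^ n"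
    using wp_term_bound [OF assms(1) rR(1-4) assms(3,4)] by blast
  show ?thesis
  proof (rule summable_comparison_test')
    show "summable (\<lambda>n. C * (norm (a * q) * r * R) ^ n)"
      using rR by (intro summable_mult summable_geometric) auto
    show "norm (norm (wp_term q a \<beta> \<gamma> n)) \<le> C * (norm (a * q) * r * R) ^ n" for n
      using C [of 0 n] by simp
  qed
qed

lemma wp_half_tendsto:
  assumes "norm q < 1" and "norm (a * q * \<beta> * \<gamma>) < 1"
    and "qpoch_inf (a * \<beta> * q) q \<noteq> 0" "qpoch_inf (a * \<gamma> * q) q \<noteq> 0"
  shows "(\<lambda>m. wp_half q a \<beta> (\<gamma> * q ^ m)) \<longlonglongrightarrow> wp_half q a \<beta> 0"
proof -
  obtain r R where rR: "0 < r" "norm \<beta> \<le> r" "0 < R" "norm \<gamma> \<le> R" "norm (a * q) * r * R < 1"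
    using wp_radii [OF assms(2)] by blast
  obtain C where C: "\<And>m n. norm (wp_term q a \<beta> (\<gamma> * q ^ m) n) \<le> C * (norm (a * q) * r * R) ^ n"
    using wp_term_bound [OF assms(1) rR(1-4) assms(3,4)] by blast
  have nz: "1 - a * \<beta> * q * q ^ j \<noteq> 0" for j
    using assms(1,3) by (auto simp: qpoch_inf_eq_0_iff)
  have lim: "(\<lambda>m. wp_term q a \<beta> (\<gamma> * q ^ m) n) \<longlonglongrightarrow> wp_term q a \<beta> 0 n" for n
  proof -
    have "(\<lambda>m. q ^ m) \<longlonglongrightarrow> 0"
      using assms(1) by (rule LIMSEQ_power_zero)
    then have "(\<lambda>m. wp_term q a \<beta> (\<gamma> * q ^ m) n) \<longlonglongrightarrow> wp_term q a \<beta> (\<gamma> * 0) n"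
      unfolding wp_term_def by (intro tendsto_intros) (use nz assms(1) in auto)
    then show ?thesis
      by simp
  qed
  have "summable (\<lambda>n. C * (norm (a * q) * r * R) ^ n)"
    using rR by (intro summable_mult summable_geometric) auto
  moreover have "\<forall>\<^sub>F (n, m) in at_top \<times>\<^sub>F sequentially.
      norm (wp_term q a \<beta> (\<gamma> * q ^ m) n) \<le> C * (norm (a * q) * r * R) ^ n"
    using C by (intro always_eventually) auto
  ultimately show ?thesis
    unfolding wp_half_def
    using tannerys_theorem [where a = "\<lambda>n m. wp_term q a \<beta> (\<gamma> * q ^ m) n", OF lim]
    by simp
qed

section \<open>The contiguous relation\<close>

text \<open>
  Up to factors that do not depend on \<open>k\<close>, replacing \<open>\<gamma>\<close> by \<open>\<gamma> q\<close> moves both products in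
  \<open>\<gamma>\<close> by one index, so only their end factors change. The denominators are cleared because
  \<open>q\<^sup>k = \<gamma> q\<close> may occur.
\<close>
lemma wp_term_shift:
  assumes "\<And>j. a * \<gamma> * q * q ^ j \<noteq> 1"
  shows "(1 - a * \<gamma> * q) * (1 - \<gamma> * q) * q ^ k * wp_term q a \<beta> \<gamma> k
    = (q ^ k - \<gamma> * q) * (1 - a * \<gamma> * q * q ^ k) * wp_term q a \<beta> (\<gamma> * q) k"
proof (induction k)
  case 0
  then show ?case
    by (simp add: mult_ac)
next
  case (Suc k)
  define Q where "Q = q ^ k"
  define u where "u = - (a * q) * (\<beta> - Q) / (1 - a * \<beta> * q * Q)"
  define s where "s = wp_term q a \<beta> (\<gamma> * q) k"
  define t where "t = wp_term q a \<beta> \<gamma> k"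
  define d where "d = 1 - a * \<gamma> * q * Q"
  define e where "e = 1 - a * \<gamma> * q * q * Q"
  have nz: "d \<noteq> 0" "e \<noteq> 0"
    using assms [of k] assms [of "Suc k"] by (auto simp: Q_def d_def e_def mult_ac)
  have t: "wp_term q a \<beta> \<gamma> (Suc k) = t * u * (\<gamma> - Q) / d"
    by (simp add: wp_term_def t_def u_def Q_def d_def)
  have s: "wp_term q a \<beta> (\<gamma> * q) (Suc k) = s * u * (\<gamma> * q - Q) / e"
    by (simp add: wp_term_def s_def u_def Q_def e_def mult_ac)
  have IH: "(1 - a * \<gamma> * q) * (1 - \<gamma> * q) * Q * t = (Q - \<gamma> * q) * d * s"
    using Suc by (simp add: s_def t_def Q_def d_def)
  have "(1 - a * \<gamma> * q) * (1 - \<gamma> * q) * (q * Q) * (t * u * (\<gamma> - Q) / d)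
      = ((1 - a * \<gamma> * q) * (1 - \<gamma> * q) * Q * t) * (q * u * (\<gamma> - Q)) / d"
    by simp
  also have "\<dots> = (q * Q - \<gamma> * q) * e * (s * u * (\<gamma> * q - Q) / e)"
    unfolding IH using nz by (simp add: field_simps)
  finally show ?case
    unfolding t s by (simp add: Q_def e_def mult_ac)
qed

text \<open>
  The combination of the two \<open>k\<close>-th terms on the left is \<open>G (k + 1) - G k\<close> for the
  sequence \<open>G\<close> of the proof, a certificate of Gosper type, with \<open>G k \<longlonglongrightarrow> 0\<close>. Hence the sum is the
  boundary term \<open>- G 0\<close>.
\<close>
lemma wp_half_contiguous:
  assumes q: "0 < norm q" "norm q < 1" and small: "norm (a * q * \<beta> * \<gamma>) < 1"
    and nz: "qpoch_inf (a * \<beta> * q) q \<noteq> 0" "qpoch_inf (a * \<gamma> * q) q \<noteq> 0"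
  shows "(1 - a * \<gamma> * q) * (1 - \<gamma> * q) * (1 + a * \<beta> * \<gamma> * q) * wp_half q a \<beta> \<gamma>
      - (1 - a * \<beta> * \<gamma> * q) * (1 - a * \<gamma>^2 * q^2) * wp_half q a \<beta> (\<gamma> * q)
    = - ((1 - a * \<gamma> * q) * (1 - a * \<beta>) * \<gamma> * q)"
proof -
  define s where "s = wp_term q a \<beta> (\<gamma> * q)"
  define t where "t = wp_term q a \<beta> \<gamma>"
  define G where "G k = \<gamma> * q * (1 - a * \<beta> * q ^ k) * (1 - a * \<gamma> * q * q ^ k) * s k / q ^ k" for k
  define D where "D = (1 - a * \<gamma> * q) * (1 - \<gamma> * q) * (1 + a * \<beta> * \<gamma> * q)"
  define N where "N = (1 - a * \<beta> * \<gamma> * q) * (1 - a * \<gamma>^2 * q^2)"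
  have q0: "q \<noteq> 0"
    using q by auto
  have nz\<beta>: "a * \<beta> * q * q ^ j \<noteq> 1" and nz\<gamma>: "a * \<gamma> * q * q ^ j \<noteq> 1" for j
    using nz q by (auto simp: qpoch_inf_eq_0_iff)
  have nz': "qpoch_inf (a * (\<gamma> * q) * q) q \<noteq> 0"
    using nz(2) qpoch_inf_eq_mult [of q "a * \<gamma> * q"] q by (auto simp: mult_ac)
  have small': "norm (a * q * \<beta> * (\<gamma> * q)) < 1"
  proof -
    have "norm (a * q * \<beta> * \<gamma>) * norm q \<le> norm (a * q * \<beta> * \<gamma>) * 1"
      using q by (intro mult_left_mono) auto
    then show ?thesis
      using small by (simp add: norm_mult mult_ac)
  qed
  have sum_t: "summable t" and sum_s: "summable s"
    unfolding s_def t_def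
    using summable_norm_wp_term [OF q(2) small nz] summable_norm_wp_term [OF q(2) small' nz(1) nz']
    by (auto intro: summable_norm_cancel)
  have shift: "(1 - a * \<gamma> * q) * (1 - \<gamma> * q) * q ^ k * t k
      = (q ^ k - \<gamma> * q) * (1 - a * \<gamma> * q * q ^ k) * s k" for k
    unfolding s_def t_def by (rule wp_term_shift [OF nz\<gamma>])
  have step: "D * t k - N * s k = G (Suc k) - G k" for k
  proof -
    define Q where "Q = q ^ k"
    have Q0: "Q \<noteq> 0"
      using q0 by (simp add: Q_def)
    define d where "d = 1 - a * \<beta> * q * Q"
    define e where "e = 1 - a * \<gamma> * q * q * Q"
    have de: "d \<noteq> 0" "e \<noteq> 0"
      using nz\<beta> [of k] nz\<gamma> [of "Suc k"] by (auto simp: Q_def d_def e_def mult_ac)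
    have "s (Suc k) = s k * (- (a * q) * (\<beta> - Q) * (\<gamma> * q - Q) / (d * e))"
      by (simp add: s_def wp_term_def Q_def d_def e_def mult_ac)
    then have "d * e * s (Suc k) = - (a * q) * (\<beta> - Q) * (\<gamma> * q - Q) * s k"
      using de by simp
    moreover have "Q * G (Suc k) = \<gamma> * (d * e * s (Suc k))"
      using q0 Q0 by (simp add: G_def Q_def d_def e_def mult_ac)
    ultimately have GS: "Q * G (Suc k) = - (a * \<gamma> * q * (\<beta> - Q) * (\<gamma> * q - Q) * s k)"
      by (simp add: mult_ac)
    have G0: "Q * G k = \<gamma> * q * (1 - a * \<beta> * Q) * (1 - a * \<gamma> * q * Q) * s k"
      using Q0 by (simp add: G_def Q_def)
    have "Q * (D * t k) = (1 + a * \<beta> * \<gamma> * q) * ((1 - a * \<gamma> * q) * (1 - \<gamma> * q) * Q * t k)"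
      by (simp add: D_def mult_ac)
    also have "\<dots> = (1 + a * \<beta> * \<gamma> * q) * ((Q - \<gamma> * q) * (1 - a * \<gamma> * q * Q) * s k)"
      using shift [of k] by (simp add: Q_def)
    finally have "Q * (D * t k - N * s k) = Q * (G (Suc k) - G k)"
      unfolding right_diff_distrib GS G0 N_def by algebra
    then show ?thesis
      using Q0 by simp
  qed
  \<comment> \<open>The factor \<open>1 / q\<^sup>k\<close> in \<open>G\<close> is compensated by the faster decay of the terms at \<open>\<gamma> q\<close>:
    the shift formula turns \<open>s k / q\<^sup>k\<close> into a bounded multiple of \<open>t k\<close>.\<close>
  have lim: "G \<longlonglongrightarrow> 0"
  proof (cases "\<gamma> = 0")
    case True
    then show ?thesis
      by (simp add: G_def [abs_def])
  next
    case False
    define g where "g k = \<gamma> * q * (1 - a * \<beta> * q ^ k) * ((1 - a * \<gamma> * q) * (1 - \<gamma> * q) * t k / (q ^ k - \<gamma> * q))" for k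
    have pow: "(\<lambda>k. q ^ k) \<longlonglongrightarrow> 0"
      using q by (intro LIMSEQ_power_zero)
    have t0: "t \<longlonglongrightarrow> 0"
      by (rule summable_LIMSEQ_zero [OF sum_t])
    have "g \<longlonglongrightarrow> \<gamma> * q * (1 - a * \<beta> * 0) * ((1 - a * \<gamma> * q) * (1 - \<gamma> * q) * 0 / (0 - \<gamma> * q))"
      unfolding g_def [abs_def] by (intro tendsto_intros pow t0) (use False q0 in auto)
    then have "g \<longlonglongrightarrow> 0"
      by simp
    moreover have "\<forall>\<^sub>F k in sequentially. q ^ k \<noteq> \<gamma> * q"
      by (rule tendsto_imp_eventually_ne [OF pow]) (use False q0 in auto)
    then have "\<forall>\<^sub>F k in sequentially. g k = G k"
    proof eventually_elim
      case (elim k)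
      have eq: "(1 - a * \<gamma> * q * q ^ k) * s k / q ^ k = (1 - a * \<gamma> * q) * (1 - \<gamma> * q) * t k / (q ^ k - \<gamma> * q)"
        using shift [of k] elim q0 by (simp add: frac_eq_eq mult_ac)
      have "G k = \<gamma> * q * (1 - a * \<beta> * q ^ k) * ((1 - a * \<gamma> * q * q ^ k) * s k / q ^ k)"
        by (simp add: G_def mult.assoc)
      also have "\<dots> = g k"
        unfolding eq g_def ..
      finally show ?case ..
    qed
    ultimately show ?thesis
      by (rule Lim_transform_eventually)
  qed
  have "(\<lambda>k. G (Suc k) - G k) sums (0 - G 0)"
    by (rule telescope_sums [OF lim])
  moreover have "(\<lambda>k. D * t k - N * s k) sums (D * suminf t - N * suminf s)"
    by (intro sums_diff sums_mult summable_sums sum_t sum_s)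
  ultimately have "D * suminf t - N * suminf s = - G 0"
    unfolding step by (simp add: sums_iff)
  then show ?thesis
    by (simp add: D_def N_def s_def t_def G_def wp_half_def mult_ac)
qed

text \<open>
  The terms of negative index of the bilateral series are those of positive index with
  \<open>a, b, c\<close> replaced by \<open>1/a, b/a, c/a\<close>. The term of index \<open>0\<close> occurs in both halves,
  whence \<open>- 1\<close>.
\<close>
definition wp_bilateral :: "complex \<Rightarrow> complex \<Rightarrow> complex \<Rightarrow> complex \<Rightarrow> complex" where
  "wp_bilateral q a \<beta> \<gamma> = wp_half q a \<beta> \<gamma> + wp_half q (1 / a) (a * \<beta>) (a * \<gamma>) - 1"

lemma wp_bilateral_commute: "wp_bilateral q a \<beta> \<gamma> = wp_bilateral q a \<gamma> \<beta>"
  by (simp add: wp_bilateral_def wp_half_commute)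

text \<open>
  The coefficients of the contiguous relation are invariant under
  \<open>(a, \<beta>, \<gamma>) \<mapsto> (1/a, a\<beta>, a\<gamma>)\<close>, and the two boundary terms cancel against the
  contribution of the index \<open>0\<close> that is counted twice.
\<close>
lemma wp_bilateral_contiguous:
  assumes q: "0 < norm q" "norm q < 1" and small: "norm (a * q * \<beta> * \<gamma>) < 1" and a: "a \<noteq> 0"
    and nz: "qpoch_inf (a * \<beta> * q) q \<noteq> 0" "qpoch_inf (a * \<gamma> * q) q \<noteq> 0"
      "qpoch_inf (\<beta> * q) q \<noteq> 0" "qpoch_inf (\<gamma> * q) q \<noteq> 0"
  shows "(1 - a * \<gamma> * q) * (1 - \<gamma> * q) * (1 + a * \<beta> * \<gamma> * q) * wp_bilateral q a \<beta> \<gamma>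
    = (1 - a * \<beta> * \<gamma> * q) * (1 - a * \<gamma>^2 * q^2) * wp_bilateral q a \<beta> (\<gamma> * q)"
proof -
  define x where "x = wp_half q a \<beta> \<gamma>"
  define x' where "x' = wp_half q a \<beta> (\<gamma> * q)"
  define y where "y = wp_half q (1 / a) (a * \<beta>) (a * \<gamma>)"
  define y' where "y' = wp_half q (1 / a) (a * \<beta>) (a * (\<gamma> * q))"
  have "(1 - a * \<gamma> * q) * (1 - \<gamma> * q) * (1 + a * \<beta> * \<gamma> * q) * x
      - (1 - a * \<beta> * \<gamma> * q) * (1 - a * \<gamma>^2 * q^2) * x'
    = - ((1 - a * \<gamma> * q) * (1 - a * \<beta>) * \<gamma> * q)"
    unfolding x_def x'_def by (rule wp_half_contiguous [OF q small nz(1,2)])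
  moreover have "(1 - \<gamma> * q) * (1 - a * \<gamma> * q) * (1 + a * \<beta> * \<gamma> * q) * y
      - (1 - a * \<beta> * \<gamma> * q) * (1 - a * \<gamma>^2 * q^2) * y'
    = - ((1 - \<gamma> * q) * (1 - \<beta>) * (a * \<gamma>) * q)"
    unfolding y_def y'_def
    using wp_half_contiguous [OF q, of "1 / a" "a * \<beta>" "a * \<gamma>"] small a nz(3,4)
    by (simp add: mult_ac power2_eq_square)
  ultimately show ?thesis
    unfolding wp_bilateral_def x_def [symmetric] x'_def [symmetric] y_def [symmetric] y'_def [symmetric]
    by algebra
qed

lemma qpoch_inf_shift_nonzero:
  assumes "norm p < 1" and "qpoch_inf x p \<noteq> 0"
  shows "qpoch_inf (x * p ^ n) p \<noteq> 0"
  using assms qpoch_inf_split [of p x n] by auto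

text \<open>
  Iterating the contiguous relation \<open>\<gamma> \<rightarrow> \<gamma> q \<rightarrow> \<gamma> q\<^sup>2 \<rightarrow> \<dots>\<close> builds up the partial products
  of the infinite products, while the series tends to its value at \<open>\<gamma> = 0\<close>.
\<close>
lemma wp_bilateral_eliminate:
  assumes q: "0 < norm q" "norm q < 1" and small: "norm (a * q * \<beta> * \<gamma>) < 1" and a: "a \<noteq> 0"
    and nz: "qpoch_inf (a * \<beta> * q) q \<noteq> 0" "qpoch_inf (a * \<gamma> * q) q \<noteq> 0"
      "qpoch_inf (\<beta> * q) q \<noteq> 0" "qpoch_inf (\<gamma> * q) q \<noteq> 0"
  shows "qpoch_inf (a * \<gamma> * q) q * qpoch_inf (\<gamma> * q) q * qpoch_inf (- (a * \<beta> * \<gamma> * q)) q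
      * wp_bilateral q a \<beta> \<gamma>
    = qpoch_inf (a * \<beta> * \<gamma> * q) q * qpoch_inf (a * \<gamma>^2 * q^2) (q^2) * wp_bilateral q a \<beta> 0"
proof -
  have q2: "norm (q^2) < 1"
    using q by (simp add: norm_power power_less_one_iff)
  have step: "(\<Prod>k<n. 1 - a * \<gamma> * q * q ^ k) * (\<Prod>k<n. 1 - \<gamma> * q * q ^ k)
        * (\<Prod>k<n. 1 - (- (a * \<beta> * \<gamma> * q)) * q ^ k) * wp_bilateral q a \<beta> \<gamma>
      = (\<Prod>k<n. 1 - a * \<beta> * \<gamma> * q * q ^ k) * (\<Prod>k<n. 1 - a * \<gamma>^2 * q^2 * (q^2) ^ k)
        * wp_bilateral q a \<beta> (\<gamma> * q ^ n)" (is "?L n * _ = ?R n * _") for n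
  proof (induction n)
    case (Suc n)
    define g where "g = \<gamma> * q ^ n"
    have "norm (a * q * \<beta> * \<gamma>) * norm q ^ n \<le> norm (a * q * \<beta> * \<gamma>) * 1"
      using q by (intro mult_left_mono power_le_one) auto
    then have g: "norm (a * q * \<beta> * g) < 1"
      using small by (simp add: g_def norm_mult norm_power mult_ac)
    have nzg: "qpoch_inf (a * g * q) q \<noteq> 0" "qpoch_inf (g * q) q \<noteq> 0"
      using qpoch_inf_shift_nonzero [OF q(2) nz(2), of n] qpoch_inf_shift_nonzero [OF q(2) nz(4), of n]
      by (simp_all add: g_def mult_ac)
    have "?L (Suc n) * wp_bilateral q a \<beta> \<gamma>
        = ((1 - a * g * q) * (1 - g * q) * (1 + a * \<beta> * g * q)) * (?L n * wp_bilateral q a \<beta> \<gamma>)"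
      by (simp add: g_def mult_ac)
    also have "\<dots> = ?R n * ((1 - a * g * q) * (1 - g * q) * (1 + a * \<beta> * g * q) * wp_bilateral q a \<beta> g)"
      unfolding Suc by (simp add: g_def mult_ac)
    also have "\<dots> = ?R n * ((1 - a * \<beta> * g * q) * (1 - a * g^2 * q^2) * wp_bilateral q a \<beta> (g * q))"
      using wp_bilateral_contiguous [OF q g a nz(1) nzg(1) nz(3) nzg(2)] by simp
    also have "\<dots> = ?R (Suc n) * wp_bilateral q a \<beta> (\<gamma> * q ^ Suc n)"
      by (simp add: g_def mult_ac power_mult_distrib power2_eq_square)
    finally show ?case .
  qed simp
  have "(\<lambda>n. ?L n * wp_bilateral q a \<beta> \<gamma>) \<longlonglongrightarrow> qpoch_inf (a * \<gamma> * q) q * qpoch_inf (\<gamma> * q) q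
      * qpoch_inf (- (a * \<beta> * \<gamma> * q)) q * wp_bilateral q a \<beta> \<gamma>"
    by (intro tendsto_intros qpoch_inf_LIMSEQ q)
  moreover have "(\<lambda>n. wp_bilateral q a \<beta> (\<gamma> * q ^ n)) \<longlonglongrightarrow> wp_bilateral q a \<beta> 0"
  proof -
    have "(\<lambda>n. wp_half q (1 / a) (a * \<beta>) ((a * \<gamma>) * q ^ n)) \<longlonglongrightarrow> wp_half q (1 / a) (a * \<beta>) 0"
      using small a nz q by (intro wp_half_tendsto) (simp_all add: mult_ac)
    then have "(\<lambda>n. wp_half q (1 / a) (a * \<beta>) (a * (\<gamma> * q ^ n))) \<longlonglongrightarrow> wp_half q (1 / a) (a * \<beta>) (a * 0)"
      by (simp add: mult.assoc)
    with wp_half_tendsto [OF q(2) small nz(1,2)] show ?thesis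
      unfolding wp_bilateral_def by (intro tendsto_intros)
  qed
  then have "(\<lambda>n. ?R n * wp_bilateral q a \<beta> (\<gamma> * q ^ n)) \<longlonglongrightarrow>
      qpoch_inf (a * \<beta> * \<gamma> * q) q * qpoch_inf (a * \<gamma>^2 * q^2) (q^2) * wp_bilateral q a \<beta> 0"
    by (intro tendsto_mult qpoch_inf_LIMSEQ q q2)
  ultimately show ?thesis
    unfolding step using LIMSEQ_unique by blast
qed

text \<open>
  Bailey's summation of the well-poised \<open>\<^sub>2\<psi>\<^sub>2\<close> with its denominators cleared: eliminate \<open>\<gamma>\<close>,
  then eliminate \<open>\<beta>\<close> by symmetry. The value at \<open>\<beta> = \<gamma> = 0\<close> is a theta series.
\<close>
lemma wp_bilateral_eq:
  assumes q: "0 < norm q" "norm q < 1" and small: "norm (a * q * \<beta> * \<gamma>) < 1" and a: "a \<noteq> 0"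
    and nz: "qpoch_inf (a * \<beta> * q) q \<noteq> 0" "qpoch_inf (a * \<gamma> * q) q \<noteq> 0"
      "qpoch_inf (\<beta> * q) q \<noteq> 0" "qpoch_inf (\<gamma> * q) q \<noteq> 0"
  shows "qpoch_inf (a * \<beta> * q) q * qpoch_inf (\<beta> * q) q * qpoch_inf (a * \<gamma> * q) q * qpoch_inf (\<gamma> * q) q
      * qpoch_inf (- (a * \<beta> * \<gamma> * q)) q * wp_bilateral q a \<beta> \<gamma>
    = qpoch_inf (a * \<beta> * \<gamma> * q) q * qpoch_inf (a * \<beta>^2 * q^2) (q^2) * qpoch_inf (a * \<gamma>^2 * q^2) (q^2)
      * wp_bilateral q a 0 0"
proof -
  have "qpoch_inf (a * \<beta> * q) q * qpoch_inf (\<beta> * q) q * wp_bilateral q a \<beta> 0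
      = qpoch_inf (a * \<beta>^2 * q^2) (q^2) * wp_bilateral q a 0 0"
    using wp_bilateral_eliminate [OF q _ a _ nz(1) _ nz(3), of 0]
    by (simp add: wp_bilateral_commute [of q a \<beta>])
  with wp_bilateral_eliminate [OF q small a nz] show ?thesis
    by algebra
qed


section \<open>Sums over the integers\<close>

lemma has_sum_int_halves:
  fixes f g :: "nat \<Rightarrow> 'a :: banach"
  assumes "summable (\<lambda>n. norm (f n))" "summable (\<lambda>n. norm (g n))" and "f 0 = g 0"
  shows "((\<lambda>k::int. if k \<ge> 0 then f (nat k) else g (nat (- k))) has_sum (suminf f + suminf g - f 0)) UNIV"
proof -
  define h where "h = (\<lambda>k::int. if k \<ge> 0 then f (nat k) else g (nat (- k)))"
  have f: "(f has_sum suminf f) UNIV"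
    using assms(1) summable_norm_cancel by (intro norm_summable_imp_has_sum summable_sums) auto
  have g: "(g has_sum suminf g) UNIV"
    using assms(2) summable_norm_cancel by (intro norm_summable_imp_has_sum summable_sums) auto
  have "(h has_sum suminf f) {0..}"
  proof -
    have "(f has_sum suminf f) UNIV \<longleftrightarrow> (h has_sum suminf f) {0..}"
      by (rule has_sum_reindex_bij_witness [of _ nat int]) (auto simp: h_def)
    with f show ?thesis
      by simp
  qed
  moreover have "(h has_sum (suminf g - f 0)) {..<0}"
  proof -
    have "(g has_sum (suminf g - g 0)) (UNIV - {0})"
      by (intro has_sum_Diff g has_sum_finiteI) auto
    moreover have "(g has_sum (suminf g - g 0)) (UNIV - {0}) \<longleftrightarrow> (h has_sum (suminf g - f 0)) {..<0}"
      by (rule has_sum_reindex_bij_witness [of _ "\<lambda>k. nat (- k)" "\<lambda>n. - int n"])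
         (auto simp: h_def assms(3))
    ultimately show ?thesis
      by simp
  qed
  ultimately have "(h has_sum (suminf f + (suminf g - f 0))) ({0..} \<union> {..<0})"
    by (rule has_sum_Un_disjoint) auto
  moreover have "{0..} \<union> {..<0} = (UNIV :: int set)"
    by auto
  ultimately show ?thesis
    by (simp add: h_def add_diff_eq)
qed

lemma abs_summable_int_halves:
  fixes f g :: "nat \<Rightarrow> 'a :: banach"
  assumes "summable (\<lambda>n. norm (f n))" "summable (\<lambda>n. norm (g n))" and "f 0 = g 0"
  shows "(\<lambda>k::int. norm (if k \<ge> 0 then f (nat k) else g (nat (- k)))) summable_on UNIV"
proof -
  have "(\<lambda>k::int. if k \<ge> 0 then norm (f (nat k)) else norm (g (nat (- k)))) summable_on UNIV"
    using has_sum_int_halves [of "\<lambda>n. norm (f n)" "\<lambda>n. norm (g n)"] assms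
    by (auto intro: has_sum_imp_summable)
  then show ?thesis
    by (simp add: if_distrib)
qed

lemma has_sum_product:
  fixes f :: "'a \<Rightarrow> 'c :: {banach, real_normed_field}" and g :: "'b \<Rightarrow> 'c"
  assumes "(\<lambda>x. norm (f x)) summable_on A" "(\<lambda>y. norm (g y)) summable_on B" and "(f has_sum s) A" "(g has_sum t) B"
  shows "((\<lambda>(x, y). f x * g y) has_sum (s * t)) (A \<times> B)"
proof (rule has_sum_SigmaI)
  show "((\<lambda>y. case (x, y) of (x, y) \<Rightarrow> f x * g y) has_sum f x * t) B" for x
    using has_sum_cmult_right [OF assms(4)] by simp
  show "((\<lambda>x. f x * t) has_sum s * t) A"
    by (rule has_sum_cmult_left [OF assms(3)])
  have "(\<lambda>z. norm (case z of (x, y) \<Rightarrow> f x * g y)) summable_on A \<times> B"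
    unfolding Infinite_Sum.abs_summable_on_Sigma_iff
    using assms(1,2)
    by (auto simp: norm_mult infsum_cmult_right' abs_mult summable_on_cmult_left summable_on_cmult_right)
  then show "(\<lambda>(x, y). f x * g y) summable_on A \<times> B"
    by (rule abs_summable_summable)
qed

section \<open>Jacobi's triple product\<close>

definition theta_term :: "complex \<Rightarrow> complex \<Rightarrow> int \<Rightarrow> complex" where
  "theta_term q a k = (- a) powi k * q powi (k * k)"

definition theta :: "complex \<Rightarrow> complex \<Rightarrow> complex" where
  "theta q a = (\<Sum>\<^sub>\<infinity>k. theta_term q a k)"

lemma wp_term_0_0: "wp_term q a 0 0 n = (- a) ^ n * q ^ (n * n)"
proof (induction n)
  case (Suc n)
  have "wp_term q a 0 0 (Suc n) = wp_term q a 0 0 n * (- (a * q) * q ^ n * q ^ n)"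
    by (simp add: wp_term_def)
  then show ?case
    unfolding Suc by (simp add: power_add mult_ac)
qed (simp add: wp_term_def)

lemma
  assumes q: "0 < norm q" "norm q < 1" and a: "a \<noteq> 0"
  shows theta_eq_wp_bilateral: "theta q a = wp_bilateral q a 0 0"
    and has_sum_theta: "(theta_term q a has_sum theta q a) UNIV"
    and abs_summable_theta: "(\<lambda>k. norm (theta_term q a k)) summable_on UNIV"
proof -
  have "nat (- k) * nat (- k) = nat (k * k)" if "k < 0" for k
    using that by (simp flip: nat_mult_distrib)
  then have eq: "(\<lambda>k. if k \<ge> 0 then wp_term q a 0 0 (nat k) else wp_term q (1 / a) 0 0 (nat (- k)))
      = theta_term q a"
    by (auto simp: fun_eq_iff wp_term_0_0 theta_term_def power_int_def divide_simps nat_mult_distrib zero_le_mult_iff)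
  have f: "summable (\<lambda>n. norm (wp_term q a 0 0 n))"
    and g: "summable (\<lambda>n. norm (wp_term q (1 / a) 0 0 n))"
    using q by (intro summable_norm_wp_term; simp)+
  have "wp_term q a 0 0 0 = wp_term q (1 / a) 0 0 0"
    by simp
  note halves = has_sum_int_halves [OF f g this] abs_summable_int_halves [OF f g this]
  have "(theta_term q a has_sum wp_bilateral q a 0 0) UNIV"
    using halves(1) unfolding eq by (simp add: wp_bilateral_def wp_half_def wp_term_0_0)
  then show "theta q a = wp_bilateral q a 0 0"
    unfolding theta_def by (rule infsumI)
  with \<open>(theta_term q a has_sum wp_bilateral q a 0 0) UNIV\<close>
  show "(theta_term q a has_sum theta q a) UNIV"
    by simp
  show "(\<lambda>k. norm (theta_term q a k)) summable_on UNIV"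
    using halves(2) by (simp flip: eq)
qed

lemma theta_inverse:
  assumes "a \<noteq> 0"
  shows "theta q (1 / a) = theta q a"
  unfolding theta_def
  by (rule infsum_reindex_bij_witness [of _ uminus uminus])
     (auto simp: theta_term_def power_int_minus power_int_divide_distrib power_int_minus_left divide_simps)

lemma theta_shift:
  assumes q: "0 < norm q" "norm q < 1" and a: "a \<noteq> 0"
  shows "a * q * theta q (a * q^2) = - theta q a"
proof -
  have q0: "q \<noteq> 0"
    using q by auto
  have "((\<lambda>k. a * q * theta_term q (a * q^2) k) has_sum a * q * theta q (a * q^2)) UNIV"
    using q0 by (intro has_sum_cmult_right has_sum_theta q) (use a in auto)
  moreover have "((\<lambda>k. a * q * theta_term q (a * q^2) k) has_sum - theta q a) UNIV
      \<longleftrightarrow> ((\<lambda>k. - theta_term q a k) has_sum - theta q a) UNIV"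
  proof (rule has_sum_reindex_bij_witness [of _ "\<lambda>k. k - 1" "\<lambda>k. k + 1"])
    fix k
    have "q * (q^2) powi k * q powi (k * k) = q powi (1 + 2 * k + k * k)"
      using q0 by (simp add: power_int_add power_int_power)
    also have "1 + 2 * k + k * k = (k + 1) * (k + 1)"
      by algebra
    finally have "q * (q^2) powi k * q powi (k * k) = q powi ((k + 1) * (k + 1))" .
    moreover have "a * q * theta_term q (a * q^2) k = a * (- a) powi k * (q * (q^2) powi k * q powi (k * k))"
      by (simp only: theta_term_def minus_mult_left power_int_mult_distrib mult_ac)
    moreover have "theta_term q a (k + 1) = - (a * (- a) powi k * q powi ((k + 1) * (k + 1)))"
      using a by (simp add: theta_term_def power_int_add)
    ultimately show "- theta_term q a (k + 1) = a * q * theta_term q (a * q^2) k"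
      by (simp only: minus_minus)
  qed auto
  moreover have "((\<lambda>k. - theta_term q a k) has_sum - theta q a) UNIV"
    by (intro has_sum_uminusI has_sum_theta q a)
  ultimately show ?thesis
    using has_sum_unique by blast
qed

lemma wp_half_1_right: "wp_half q a \<beta> 1 = 1"
proof -
  have "wp_term q a \<beta> 1 n = 0" if "n \<notin> {0}" for n
    using that by (auto simp: wp_term_def intro!: bexI [of _ 0])
  then have "wp_half q a \<beta> 1 = (\<Sum>n\<in>{0}. wp_term q a \<beta> 1 n)"
    unfolding wp_half_def by (intro suminf_finite) auto
  then show ?thesis
    by (simp add: wp_term_def)
qed

text \<open>
  For \<open>\<beta> = 1/a\<close> and \<open>\<gamma> = 1\<close> both halves of the well-poised series terminate after their
  first term, so the series is \<open>1\<close> and its summation formula determines the theta series. This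
  needs \<open>aq\<close> and \<open>q/a\<close> to avoid \<open>1, q\<^sup>-\<^sup>1, q\<^sup>-\<^sup>2, \<dots>\<close>, so it misses the values \<open>a = q\<^sup>n\<close> with
  \<open>n \<noteq> 0\<close>. Both sides are invariant under \<open>a \<mapsto> 1/a\<close> and have the same quasi-period
  \<open>q\<^sup>2\<close>, which reduces these values to \<open>a = 1\<close>, where the first argument applies, and \<open>a = q\<close>,
  where both sides vanish.
\<close>
theorem Jacobi_triple_product:
  assumes q: "0 < norm q" "norm q < 1" and a: "a \<noteq> 0"
  shows "theta q a = qpoch_inf (q^2) (q^2) * qpoch_inf (a * q) (q^2) * qpoch_inf (q / a) (q^2)"
proof -
  define R where "R a = qpoch_inf (q^2) (q^2) * qpoch_inf (a * q) (q^2) * qpoch_inf (q / a) (q^2)" for a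
  have q0: "q \<noteq> 0"
    using q by auto
  have q2: "norm (q^2) < 1"
    using q by (simp add: norm_power power_less_one_iff)
  have qq: "qpoch_inf q q \<noteq> 0"
    by (rule qpoch_inf_self_nonzero [OF q(2)])
  have generic: "theta q a = R a"
    if a: "a \<noteq> 0" and nz: "qpoch_inf (a * q) q \<noteq> 0" "qpoch_inf (q / a) q \<noteq> 0" for a
  proof -
    have "wp_half q a (1 / a) 1 = 1" "wp_half q (1 / a) 1 a = 1"
      by (simp_all add: wp_half_1_right wp_half_commute [of q "1 / a" 1])
    then have "wp_bilateral q a (1 / a) 1 = 1"
      using a by (simp add: wp_bilateral_def)
    then have "qpoch_inf q q * qpoch_inf (q / a) q * qpoch_inf (a * q) q * qpoch_inf q q * qpoch_inf (- q) q
        = qpoch_inf q q * qpoch_inf (q^2 / a) (q^2) * qpoch_inf (a * q^2) (q^2) * theta q a"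
      using wp_bilateral_eq [OF q _ a, of "1 / a" 1] a nz qq q
      by (simp add: theta_eq_wp_bilateral power2_eq_square)
    moreover have "qpoch_inf q q * qpoch_inf (- q) q = qpoch_inf (q^2) (q^2)"
      by (rule qpoch_inf_mult_uminus [OF q(2)])
    moreover have "qpoch_inf (a * q) q = qpoch_inf (a * q) (q^2) * qpoch_inf (a * q^2) (q^2)"
      using qpoch_inf_bisect [OF q(2), of "a * q"] by (simp add: power2_eq_square mult_ac)
    moreover have "qpoch_inf (q / a) q = qpoch_inf (q / a) (q^2) * qpoch_inf (q^2 / a) (q^2)"
      using qpoch_inf_bisect [OF q(2), of "q / a"] by (simp add: power2_eq_square mult_ac)
    moreover have "qpoch_inf (a * q^2) (q^2) * qpoch_inf (q^2 / a) (q^2) * qpoch_inf q q \<noteq> 0"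
      using nz qq calculation(3,4) by auto
    ultimately show ?thesis
      unfolding R_def by (algebra)
  qed
  have R_shift: "a * q * R (a * q^2) = - R a" if "a \<noteq> 0" for a
  proof -
    have 1: "qpoch_inf (a * q) (q^2) = (1 - a * q) * qpoch_inf (a * q^2 * q) (q^2)"
      using qpoch_inf_eq_mult [OF q2, of "a * q"] by (simp add: mult_ac)
    have 2: "qpoch_inf (q / (a * q^2)) (q^2) = (1 - 1 / (a * q)) * qpoch_inf (q / a) (q^2)"
      using qpoch_inf_eq_mult [OF q2, of "q / (a * q^2)"] that q0
      by (simp add: power2_eq_square field_simps)
    have "a * q * (1 - 1 / (a * q)) = - (1 - a * q)"
      using that q0 by (simp add: field_simps)
    then show ?thesis
      unfolding R_def 1 2 by algebra
  qed
  have powers: "theta q (q ^ n) = R (q ^ n)" for n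
  proof (induction n rule: less_induct)
    case (less n)
    consider "n = 0" | "n = 1" | m where "n = m + 2"
      by (metis One_nat_def Suc_1 add_2_eq_Suc' not0_implies_Suc)
    then show ?case
    proof cases
      case 1
      then show ?thesis
        using generic [of 1] qq by simp
    next
      case 2
      have "theta q q = - theta q q"
        using theta_shift [OF q, of "1 / q"] theta_inverse [OF q0] q0 by (simp add: power2_eq_square)
      then have "theta q q = 0"
        by simp
      moreover have "R q = 0"
        using qpoch_inf_eq_mult [OF q2, of 1] q0 by (simp add: R_def)
      ultimately show ?thesis
        using 2 by simp
    next
      case 3
      then have "theta q (q ^ m) = R (q ^ m)"
        using less by simp
      then have "q ^ m * q * theta q (q ^ m * q^2) = q ^ m * q * R (q ^ m * q^2)"
        using theta_shift [OF q, of "q ^ m"] R_shift [of "q ^ m"] q0 by simp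
      moreover have "q ^ n = q ^ m * q^2"
        unfolding 3 by (rule power_add)
      ultimately show ?thesis
        using q0 by simp
    qed
  qed
  have "theta q a = R a"
  proof -
    consider "qpoch_inf (a * q) q \<noteq> 0" "qpoch_inf (q / a) q \<noteq> 0"
      | k where "a * q * q ^ k = 1" | k where "q / a * q ^ k = 1"
      using qpoch_inf_eq_0_iff [OF q(2)] by blast
    then show ?thesis
    proof cases
      case 1
      then show ?thesis
        using generic a by blast
    next
      case 2
      then have "a = 1 / q ^ Suc k"
        using a q0 by (simp add: field_simps)
      moreover have "R (1 / q ^ Suc k) = R (q ^ Suc k)"
        by (simp add: R_def mult_ac)
      ultimately show ?thesis
        using powers [of "Suc k"] theta_inverse [of "q ^ Suc k" q] q0 by simp
    next
      case 3
      then have "a = q ^ Suc k"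
        using a by (simp add: field_simps)
      then show ?thesis
        by (simp only: powers)
    qed
  qed
  then show ?thesis
    by (simp add: R_def)
qed

section \<open>An addition formula for theta functions\<close>

text \<open>
  In the double series on the left the terms with \<open>m - n\<close> odd cancel and the others double.
  On the sublattice where \<open>m - n\<close> is even, \<open>m = r + s\<close> and \<open>n = r - s\<close> give
  \<open>m\<^sup>2 + n\<^sup>2 = 2r\<^sup>2 + 2s\<^sup>2\<close>, and the series factors.
\<close>
lemma theta_addition:
  assumes p: "0 < norm p" "norm p < 1" and u: "u \<noteq> 0" and v: "v \<noteq> 0"
  shows "theta p (- u) * theta p v + theta p u * theta p (- v)
    = 2 * theta (p^2) (u * v) * theta (p^2) (u / v)"
proof -
  have p0: "p \<noteq> 0"
    using p by auto
  have p2: "0 < norm (p^2)" "norm (p^2) < 1"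
    using p by (simp_all add: norm_power power_less_one_iff)
  define F where "F = (\<lambda>(m, n). theta_term p (- u) m * theta_term p v n + theta_term p u m * theta_term p (- v) n)"
  define E :: "(int \<times> int) set" where "E = {(m, n). even (m - n)}"
  have F1: "(F has_sum theta p (- u) * theta p v + theta p u * theta p (- v)) (UNIV \<times> UNIV)"
  proof -
    have "((\<lambda>(m, n). theta_term p x m * theta_term p y n) has_sum theta p x * theta p y) (UNIV \<times> UNIV)"
      if "x \<noteq> 0" "y \<noteq> 0" for x y
      using that by (intro has_sum_product abs_summable_theta has_sum_theta p)
    from has_sum_add [OF this [of "- u" v] this [of u "- v"]] u v show ?thesis
      by (simp add: F_def case_prod_unfold)
  qed
  have F2: "(F has_sum s) (UNIV \<times> UNIV) \<longleftrightarrow> (F has_sum s) E" for s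
  proof (rule has_sum_cong_neutral)
    fix x assume "x \<in> UNIV \<times> UNIV - E"
    then obtain m n where "x = (m, n)" "even m \<longleftrightarrow> odd n"
      by (cases x) (auto simp: E_def)
    then show "F x = 0"
      by (auto simp: F_def theta_term_def power_int_minus_left)
  qed (auto simp: E_def)
  have F3: "(F has_sum s) E
      \<longleftrightarrow> ((\<lambda>(r, s). 2 * (theta_term (p^2) (u * v) r * theta_term (p^2) (u / v) s)) has_sum s) (UNIV \<times> UNIV)" for s
  proof (rule has_sum_reindex_bij_witness [of _ "\<lambda>(r, s). (r + s, r - s)" "\<lambda>(m, n). ((m + n) div 2, (m - n) div 2)"])
    fix x assume "x \<in> E"
    then obtain m n where x: "x = (m, n)" "even (m - n)"
      by (auto simp: E_def)
    define r where "r = (m + n) div 2"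
    define s where "s = (m - n) div 2"
    have mn: "m = r + s" "n = r - s"
      using x(2) by (auto simp: r_def s_def elim!: evenE; presburger)+
    have sq: "p powi (m * m) * p powi (n * n) = (p^2) powi (r * r) * (p^2) powi (s * s)"
    proof -
      have "p powi (m * m) * p powi (n * n) = p powi (2 * (r * r) + 2 * (s * s))"
        using p0 by (simp add: mn power_int_add [symmetric] algebra_simps)
      then show ?thesis
        using p0 by (simp add: power_int_add power_int_power)
    qed
    have uv: "u powi m * v powi n = (u * v) powi r * (u / v) powi s"
      using u v by (simp add: mn power_int_add power_int_diff power_int_mult_distrib power_int_divide_distrib)
    have sgn: "(- 1) powi m = (- 1 :: complex) powi n" "(- 1) powi m = (- 1) powi r * (- 1 :: complex) powi s"
      by (auto simp: mn power_int_minus_left)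
    have th: "theta_term b (- a) k = a powi k * b powi (k * k)"
      "theta_term b a k = (- 1) powi k * a powi k * b powi (k * k)" for a b k
      by (auto simp: theta_term_def power_int_minus_left)
    have "F (m, n) = 2 * (- 1) powi m * (u powi m * v powi n) * (p powi (m * m) * p powi (n * n))"
      unfolding F_def prod.case th(1) unfolding th(2) sgn(1) by simp
    also have "\<dots> = 2 * (theta_term (p^2) (u * v) r * theta_term (p^2) (u / v) s)"
      unfolding sgn(2) uv sq th by simp
    finally show "(case (case x of (m, n) \<Rightarrow> ((m + n) div 2, (m - n) div 2)) of
        (r, s) \<Rightarrow> 2 * (theta_term (p^2) (u * v) r * theta_term (p^2) (u / v) s)) = F x"
      by (simp add: x r_def s_def)
    show "(case (case x of (m, n) \<Rightarrow> ((m + n) div 2, (m - n) div 2)) of (r, s) \<Rightarrow> (r + s, r - s)) = x"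
      unfolding x prod.case r_def [symmetric] s_def [symmetric] by (simp add: mn)
  qed (auto simp: E_def)
  have "((\<lambda>(r, s). 2 * (theta_term (p^2) (u * v) r * theta_term (p^2) (u / v) s)) has_sum
      2 * (theta (p^2) (u * v) * theta (p^2) (u / v))) (UNIV \<times> UNIV)"
  proof -
    have "((\<lambda>(r, s). theta_term (p^2) (u * v) r * theta_term (p^2) (u / v) s) has_sum
        theta (p^2) (u * v) * theta (p^2) (u / v)) (UNIV \<times> UNIV)"
      using u v by (intro has_sum_product abs_summable_theta has_sum_theta p2) auto
    from has_sum_cmult_right [OF this, of 2] show ?thesis
      by (simp add: case_prod_unfold)
  qed
  then have "(F has_sum 2 * (theta (p^2) (u * v) * theta (p^2) (u / v))) (UNIV \<times> UNIV)"
    unfolding F2 F3 .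
  from has_sum_unique [OF F1 this] show ?thesis
    by (simp add: mult.assoc)
qed

text \<open>
  The theta addition formula in the base \<open>p = \<surd>q\<close>, at \<open>u = b/p\<close> and \<open>v = b/(ap)\<close>, with all
  theta series except that of \<open>u / v = a\<close> written as products.
\<close>
lemma theta_products_addition:
  assumes q: "0 < norm q" "norm q < 1" and a: "a \<noteq> 0" and b: "b \<noteq> 0"
  shows "(qpoch_inf q q)^2 *
      (qpoch_inf (- b) q * qpoch_inf (- (q / b)) q * qpoch_inf (b / a) q * qpoch_inf (a * q / b) q
        + qpoch_inf b q * qpoch_inf (q / b) q * qpoch_inf (- (b / a)) q * qpoch_inf (- (a * q / b)) q)
    = 2 * qpoch_inf (q^2) (q^2) * qpoch_inf (b^2 / a) (q^2) * qpoch_inf (a * q^2 / b^2) (q^2) * theta q a"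
proof -
  define p where "p = csqrt q"
  have pq: "p^2 = q"
    by (simp add: p_def)
  then have pp: "p * p = q"
    by (simp add: power2_eq_square)
  have p: "0 < norm p" "norm p < 1"
    using q unfolding pq [symmetric] by (auto simp: norm_power power_less_one_iff)
  have p0: "p \<noteq> 0" and q0: "q \<noteq> 0"
    using p q by auto
  define u where "u = b / p"
  define v where "v = b / (a * p)"
  have uv: "u \<noteq> 0" "v \<noteq> 0"
    using a b p0 by (auto simp: u_def v_def)
  have arg: "u * p = b" "p / u = q / b" "v * p = b / a" "p / v = a * q / b" "u / v = a"
    "u * v * q = b^2 / a" "q / (u * v) = a * q^2 / b^2"
    using a b p0 by (simp_all add: u_def v_def pq [symmetric] field_simps power2_eq_square)
  have "theta p (- u) = qpoch_inf q q * qpoch_inf (- b) q * qpoch_inf (- (q / b)) q"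
    "theta p u = qpoch_inf q q * qpoch_inf b q * qpoch_inf (q / b) q"
    "theta p (- v) = qpoch_inf q q * qpoch_inf (- (b / a)) q * qpoch_inf (- (a * q / b)) q"
    "theta p v = qpoch_inf q q * qpoch_inf (b / a) q * qpoch_inf (a * q / b) q"
    using Jacobi_triple_product [OF p, of u] Jacobi_triple_product [OF p, of "- u"]
      Jacobi_triple_product [OF p, of v] Jacobi_triple_product [OF p, of "- v"] uv
    by (simp_all add: pq arg)
  moreover have "theta q (u * v) = qpoch_inf (q^2) (q^2) * qpoch_inf (b^2 / a) (q^2) * qpoch_inf (a * q^2 / b^2) (q^2)"
    using Jacobi_triple_product [OF q, of "u * v"] uv by (simp add: arg)
  ultimately show ?thesis
    using theta_addition [OF p uv] unfolding pq arg
    by (simp add: power2_eq_square algebra_simps)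
qed

section \<open>The bilateral series and its sum\<close>

lemma prod_uminus_int_index:
  fixes q x :: complex
  assumes "q \<noteq> 0"
  shows "(\<Prod>j<n. 1 - (x * q powi (- int n)) * q ^ j) = (\<Prod>j<n. 1 - x / (q * q ^ j))"
proof -
  have "(\<Prod>j<n. 1 - (x * q powi (- int n)) * q ^ j) = (\<Prod>j<n. 1 - (x * q powi (- int n)) * q ^ (n - Suc j))"
    by (rule prod.nat_diff_reindex [symmetric])
  also have "\<dots> = (\<Prod>j<n. 1 - x / (q * q ^ j))"
  proof (intro prod.cong refl)
    fix j assume "j \<in> {..<n}"
    then have "q ^ n = q ^ (n - Suc j) * q ^ Suc j"
      by (metis power_add le_add_diff_inverse2 lessThan_iff Suc_leI)
    then show "1 - (x * q powi (- int n)) * q ^ (n - Suc j) = 1 - x / (q * q ^ j)"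
      using assms by (simp add: power_int_minus divide_simps)
  qed
  finally show ?thesis .
qed

text \<open>
  For \<open>k < 0\<close> a denominator factor \<open>(aq/b;q)\<^sub>k\<close> may have a pole, namely if \<open>aq/b\<close> is a
  positive power of \<open>q\<close>. Its reciprocal is then \<open>0\<close>, and so is the product
  \<open>(a/b - q\<^sup>j)\<close> over \<open>j < -k\<close> on the right.
\<close>
lemma psi22_term_eq:
  assumes q: "0 < norm q" "norm q < 1" and nz: "a \<noteq> 0" "b \<noteq> 0" "c \<noteq> 0"
    and den: "qpoch_inf (q / b) q \<noteq> 0" "qpoch_inf (q / c) q \<noteq> 0"
      "qpoch_inf (a * q / b) q \<noteq> 0" "qpoch_inf (a * q / c) q \<noteq> 0"
  shows "psi22_term b c (a * q / b) (a * q / c) q (- (a * q / (b * c))) k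
    = (if k \<ge> 0 then wp_term q a (1 / b) (1 / c) (nat k) else wp_term q (1 / a) (a / b) (a / c) (nat (- k)))"
proof (cases "k \<ge> 0")
  case True
  define n where "n = nat k"
  have k: "k = int n"
    using True by (simp add: n_def)
  have "psi22_term b c (a * q / b) (a * q / c) q (- (a * q / (b * c))) k
      = (\<Prod>j<n. (1 - b * q ^ j) * (1 - c * q ^ j) / ((1 - a * q / b * q ^ j) * (1 - a * q / c * q ^ j))
          * (- (a * q / (b * c))))"
    unfolding prod.distrib prod_dividef by (simp add: psi22_term_def qpochs_def qpoch_def k)
  also have "\<dots> = wp_term q a (1 / b) (1 / c) n"
    unfolding wp_term_def
  proof (intro prod.cong refl)
    fix j
    have "(1 - b * q ^ j) * (1 - c * q ^ j) * (- (a * q / (b * c)))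
        = - (a * q) * (1 / b - q ^ j) * (1 / c - q ^ j)"
      using nz by (simp add: field_simps)
    then show "(1 - b * q ^ j) * (1 - c * q ^ j) / ((1 - a * q / b * q ^ j) * (1 - a * q / c * q ^ j))
          * (- (a * q / (b * c)))
        = - (a * q) * (1 / b - q ^ j) * (1 / c - q ^ j)
          / ((1 - a * (1 / b) * q * q ^ j) * (1 - a * (1 / c) * q * q ^ j))"
      by (simp add: mult_ac)
  qed
  finally show ?thesis
    using True by (simp add: n_def)
next
  case False
  define n where "n = nat (- k)"
  have k: "k = - int n" "n \<noteq> 0"
    using False by (auto simp: n_def)
  have q0: "q \<noteq> 0"
    using q by auto
  have "psi22_term b c (a * q / b) (a * q / c) q (- (a * q / (b * c))) k
      = (\<Prod>j<n. (1 - (a * q / b) / (q * q ^ j)) * (1 - (a * q / c) / (q * q ^ j))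
          / ((1 - b / (q * q ^ j)) * (1 - c / (q * q ^ j))) * (1 / (- (a * q / (b * c)))))"
  proof -
    have qp: "qpoch x q k = 1 / (\<Prod>j<n. 1 - x / (q * q ^ j))" for x
      using k prod_uminus_int_index [OF q0, of x n] by (simp add: qpoch_def)
    have pw: "x powi k = (\<Prod>j<n. 1 / x)" for x :: complex
      by (simp add: k(1) power_int_minus power_one_over inverse_eq_divide)
    have "1 / x * (1 / y * 1) / (1 / u * (1 / v * 1)) * w = u * v / (x * y) * w" for x y u v w :: complex
      by simp
    then show ?thesis
      unfolding psi22_term_def qpochs_def list.map prod_list.Cons prod_list.Nil qp pw
        prod.distrib prod_dividef .
  qed
  also have "\<dots> = wp_term q (1 / a) (a / b) (a / c) n"
    unfolding wp_term_def
  proof (intro prod.cong refl)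
    fix j
    define Q where "Q = q ^ j"
    have Q: "Q \<noteq> 0"
      using q0 by (simp add: Q_def)
    have d: "1 - q * Q / b \<noteq> 0" "1 - q * Q / c \<noteq> 0"
      using den q by (auto simp: qpoch_inf_eq_0_iff Q_def)
    have num: "1 - (a * q / x) / (q * Q) = - (a / x - Q) / Q" if "x \<noteq> 0" for x
      using that q0 Q by (simp add: field_simps)
    have den: "1 - x / (q * Q) = - (x / (q * Q)) * (1 - q * Q / x)" if "x \<noteq> 0" for x
      using that q0 Q by (simp add: field_simps)
    show "(1 - (a * q / b) / (q * q ^ j)) * (1 - (a * q / c) / (q * q ^ j))
          / ((1 - b / (q * q ^ j)) * (1 - c / (q * q ^ j))) * (1 / (- (a * q / (b * c))))
        = - (1 / a * q) * (a / b - q ^ j) * (a / c - q ^ j)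
          / ((1 - 1 / a * (a / b) * q * q ^ j) * (1 - 1 / a * (a / c) * q * q ^ j))"
      unfolding Q_def [symmetric] num [OF nz(2)] num [OF nz(3)] den [OF nz(2)] den [OF nz(3)]
    proof -
      define x where "x = a / b - Q"
      define y where "y = a / c - Q"
      define u where "u = 1 - q * Q / b"
      define v where "v = 1 - q * Q / c"
      have uv: "1 - 1 / a * (a / b) * q * Q = u" "1 - 1 / a * (a / c) * q * Q = v"
        using nz by (simp_all add: u_def v_def)
      have "u \<noteq> 0" "v \<noteq> 0"
        using d by (simp_all add: u_def v_def)
      then show "- (a / b - Q) / Q * (- (a / c - Q) / Q)
          / (- (b / (q * Q)) * (1 - q * Q / b) * (- (c / (q * Q)) * (1 - q * Q / c)))
          * (1 / - (a * q / (b * c)))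
        = - (1 / a * q) * (a / b - Q) * (a / c - Q)
          / ((1 - 1 / a * (a / b) * q * Q) * (1 - 1 / a * (a / c) * q * Q))"
        unfolding uv unfolding x_def [symmetric] y_def [symmetric] u_def [symmetric] v_def [symmetric]
        using Q q0 nz by (simp add: field_simps)
    qed
  qed
  finally show ?thesis
    using False by (simp add: n_def)
qed

theorem corollary2p4:
  fixes q a b c :: complex
  assumes "0 < norm q" and "norm q < 1"
    and "norm (a * q / (b * c)) < 1"
    and "a \<noteq> 0" and "b \<noteq> 0" and "c \<noteq> 0"
    and "qpochs_inf [a * q / c, -1, q / c, q / b, - (a * q / (b * c))] q
           * qpoch_inf (b^2 / a) (q^2) \<noteq> 0"
    and "qpochs_inf [a * q / b, a * q / c, -1, - (a * q / (b * c)), q / c] q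
           * qpoch_inf (b^2 / a) (q^2) \<noteq> 0"
  shows "psi22_term b c (a * q / b) (a * q / c) q (- (a * q / (b * c))) summable_on UNIV
    \<and> psi22 b c (a * q / b) (a * q / c) q (- (a * q / (b * c)))
      = qpochs_inf [- b, a * q / (b * c), - (q / b), b / a, q] q
          * qpoch_inf (a * q^2 / c^2) (q^2)
        / (qpochs_inf [a * q / c, -1, q / c, q / b, - (a * q / (b * c))] q
            * qpoch_inf (b^2 / a) (q^2))
      + qpochs_inf [a * q / (b * c), b, - (a * q / b), - (b / a), q] q
          * qpoch_inf (a * q^2 / c^2) (q^2)
        / (qpochs_inf [a * q / b, a * q / c, -1, - (a * q / (b * c)), q / c] q
            * qpoch_inf (b^2 / a) (q^2))"
proof -
  note q = assms(1,2) and nz = assms(4-6)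
  define \<psi> where "\<psi> = wp_bilateral q a (1 / b) (1 / c)"
  define ab ac qb qc where "ab = qpoch_inf (a * q / b) q" and "ac = qpoch_inf (a * q / c) q"
    and "qb = qpoch_inf (q / b) q" and "qc = qpoch_inf (q / c) q"
  define z mz where "z = qpoch_inf (a * q / (b * c)) q" and "mz = qpoch_inf (- (a * q / (b * c))) q"
  define B B' C where "B = qpoch_inf (b^2 / a) (q^2)" and "B' = qpoch_inf (a * q^2 / b^2) (q^2)"
    and "C = qpoch_inf (a * q^2 / c^2) (q^2)"
  define e m1 mq e2 where "e = qpoch_inf q q" and "m1 = qpoch_inf (- 1) q" and "mq = qpoch_inf (- q) q"
    and "e2 = qpoch_inf (q^2) (q^2)"
  define s t where "s = qpoch_inf (- b) q * qpoch_inf (- (q / b)) q * qpoch_inf (b / a) q"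
    and "t = qpoch_inf b q * qpoch_inf (- (b / a)) q * qpoch_inf (- (a * q / b)) q"
  have den: "ab \<noteq> 0" "ac \<noteq> 0" "qb \<noteq> 0" "qc \<noteq> 0" "mz \<noteq> 0" "m1 \<noteq> 0" "B \<noteq> 0"
    using assms(7,8) by (auto simp: qpochs_inf_def ab_def ac_def qb_def qc_def mz_def m1_def B_def)
  have small: "norm (a * q * (1 / b) * (1 / c)) < 1"
    using assms(3) by simp
  have "(\<lambda>k. psi22_term b c (a * q / b) (a * q / c) q (- (a * q / (b * c))) k)
      = (\<lambda>k. if k \<ge> 0 then wp_term q a (1 / b) (1 / c) (nat k) else wp_term q (1 / a) (a / b) (a / c) (nat (- k)))"
    using psi22_term_eq [OF q nz] den by (simp add: ab_def ac_def qb_def qc_def)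
  moreover have "summable (\<lambda>n. norm (wp_term q a (1 / b) (1 / c) n))"
    using den small by (intro summable_norm_wp_term q) (auto simp: ab_def ac_def)
  moreover have "summable (\<lambda>n. norm (wp_term q (1 / a) (a / b) (a / c) n))"
    using den small nz by (intro summable_norm_wp_term q) (auto simp: qb_def qc_def mult_ac)
  ultimately have has_sum: "(psi22_term b c (a * q / b) (a * q / c) q (- (a * q / (b * c))) has_sum \<psi>) UNIV"
    using has_sum_int_halves [of "wp_term q a (1 / b) (1 / c)" "wp_term q (1 / a) (a / b) (a / c)"]
    by (simp add: \<psi>_def wp_bilateral_def wp_half_def)
  \<comment> \<open>Both \<open>\<psi>\<close> and the two-term expression are multiples of the same theta series.\<close>
  have \<psi>: "ab * qb * ac * qc * mz * \<psi> = z * B' * C * theta q a"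
    using wp_bilateral_eq [OF q small nz(1)] den theta_eq_wp_bilateral [OF q nz(1)]
    by (simp add: ab_def ac_def qb_def qc_def mz_def z_def B'_def C_def \<psi>_def power_divide)
  have add: "e^2 * (s * ab + t * qb) = 2 * e2 * B * B' * theta q a"
    using theta_products_addition [OF q nz(1,2)]
    by (simp add: e_def s_def t_def ab_def qb_def e2_def B_def B'_def mult_ac)
  have m1: "m1 = 2 * mq"
    using qpoch_inf_eq_mult [OF q(2), of "- 1"] by (simp add: m1_def mq_def)
  have e2: "e2 = e * mq"
    using qpoch_inf_mult_uminus [OF q(2), of q] by (simp add: e2_def e_def mq_def)
  have e0: "e \<noteq> 0"
    unfolding e_def by (rule qpoch_inf_self_nonzero [OF q(2)])
  have "e * (s * ab + t * qb) = m1 * B * B' * theta q a"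
  proof -
    have "e * (e * (s * ab + t * qb)) = e * (m1 * B * B' * theta q a)"
      using add unfolding m1 e2 by (simp add: power2_eq_square mult_ac)
    then show ?thesis
      using e0 by simp
  qed
  with \<psi> have "ab * qb * ac * qc * mz * \<psi> * (m1 * B) = z * C * e * (s * ab + t * qb)"
    by algebra
  then have "\<psi> = z * C * e * s / (ac * m1 * qc * qb * mz * B) + z * C * e * t / (ab * ac * m1 * mz * qc * B)"
    using den by (simp add: field_simps)
  then have "\<psi> = qpochs_inf [- b, a * q / (b * c), - (q / b), b / a, q] q
          * qpoch_inf (a * q^2 / c^2) (q^2)
        / (qpochs_inf [a * q / c, -1, q / c, q / b, - (a * q / (b * c))] q
            * qpoch_inf (b^2 / a) (q^2))
      + qpochs_inf [a * q / (b * c), b, - (a * q / b), - (b / a), q] q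
          * qpoch_inf (a * q^2 / c^2) (q^2)
        / (qpochs_inf [a * q / b, a * q / c, -1, - (a * q / (b * c)), q / c] q
            * qpoch_inf (b^2 / a) (q^2))"
    by (simp add: qpochs_inf_def ab_def ac_def qb_def qc_def z_def mz_def B_def C_def e_def m1_def
        s_def t_def mult_ac)
  with has_sum show ?thesis
    by (auto simp: psi22_def has_sum_imp_summable infsumI)
qed

end
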